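(* Let $\mathcal{E}\to\mathcal{M}$ be a dg-vector bundle, let $\mathcal{A}\to\mathcal{M}$ be a dg-Lie algebroid with anchor $\rho:\mathcal{A}\to T\mathcal{M}$, and let $\nabla$ be an $\mathcal{A}$-connection on $\mathcal{E}$. Define $$\mathrm{At}_{\mathcal{E}}(X,s):=\mathcal{Q}(\nabla_Xs)-\nabla_{\mathcal{Q}(X)}s-(-1)^{|X|}\nabla_X(\mathcal{Q}(s)),\qquad X\in\Gamma(\mathcal{A}),\ s\in\Gamma(\mathcal{E}).$$ Then: (1) $\mathrm{At}_{\mathcal{E}}:\mathcal{A}\otimes\mathcal{E}\to\mathcal{E}$ is a degree $+1$ bundle map (i.e. it is graded $C^\infty(\mathcal{M})$-bilinear of degree $+1$), and therefore can be regarded as a degree $+1$ section of $\mathcal{A}^\vee\otimes\mathrm{End}\,\mathcal{E}$. (2) $\mathrm{At}_{\mathcal{E}}$ is a cocycle: $\mathcal{Q}(\mathrm{At}_{\mathcal{E}})=0$. (3) The cohomology class of $\mathrm{At}_{\mathcal{E}}$ in $H^1(\Gamma(\mathcal{A}^\vee\otimes\mathrm{End}\,\mathcal{E}),\mathcal{Q})$ is independent of the choice of the $\mathcal{A}$-connection $\nabla$.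
   Context: A $\mathbb{Z}$-graded manifold $\mathcal{M}$ with base manifold $M$ is a sheaf of $\mathbb{Z}$-graded, graded-commutative algebras over $M$, locally isomorphic to $C^\infty(U)\otimes\hat S(V^\vee)$, with $U\subset M$ open, $V$ a $\mathbb{Z}$-graded vector space, and $\hat S(V^\vee)$ the graded algebra of formal polynomials on $V$. $C^\infty(\mathcal{M})$ is the graded algebra of global sections. A dg-manifold $(\mathcal{M},Q)$ is a $\mathbb{Z}$-graded manifold with a homological vector field $Q$ (degree $+1$ derivation of $C^\infty(\mathcal{M})$ with $[Q,Q]=0$). $|\cdot|$ denotes degree. A dg-vector bundle $\mathcal{E}\to\mathcal{M}$ is a vector bundle in the category of dg-manifolds; the homological vector fields induce a degree $+1$ operator $\mathcal{Q}$ on the graded module of sections $\Gamma(\mathcal{E})$ with $\mathcal{Q}^2=0$ and $\mathcal{Q}(fs)=Q(f)s+(-1)^{|f|}f\mathcal{Q}(s)$, i.e. $\Gamma(\mathcal{E})$ is a dg-module over $(C^\infty(\mathcal{M}),Q)$. A dg-Lie algebroid $\mathcal{A}\to\mathcal{M}$ is a Lie algebroid object in the category of dg-manifolds: a dg-vector bundle with a degree $0$ graded Lie algebroid structure (bracket on $\Gamma(\mathcal{A})$ and anchor $\rho$) such that $\mathcal{Q}$ is a degree $+1$ graded derivation of the bracket and $\rho(\mathcal{Q}(X))=[Q,\rho(X)]$. An $\mathcal{A}$-connection on $\mathcal{E}$ is a degree $0$ map $\nabla:\Gamma(\mathcal{A})\otimes\Gamma(\mathcal{E})\to\Gamma(\mathcal{E})$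 (so $|\nabla_Xs|=|X|+|s|$) with $\nabla_{fX}s=f\nabla_Xs$ and $\nabla_X(fs)=\rho(X)(f)s+(-1)^{|X||f|}f\nabla_Xs$. Degree $+1$ graded bilinearity of $\Phi$ means $\Phi(fX,s)=(-1)^{|f|}f\Phi(X,s)=(-1)^{|f||X|}\Phi(X,fs)$. The operator $\mathcal{Q}$ on $\Gamma(\mathcal{A}^\vee\otimes\mathrm{End}\,\mathcal{E})$ is the induced one: viewing a section $\Phi$ as a bundle map $\mathcal{A}\otimes\mathcal{E}\to\mathcal{E}$, $(\mathcal{Q}\Phi)(X,s)=\mathcal{Q}(\Phi(X,s))-(-1)^{|\Phi|}\Phi(\mathcal{Q}X,s)-(-1)^{|\Phi|+|X|}\Phi(X,\mathcal{Q}s)$. *)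

theory Defs
  imports "HOL-Analysis.Analysis"
begin

section \<open>Graded vector spaces\<close>

text \<open>
  A \<open>\<int>\<close>-graded real vector space is a family of linearly independent subspaces \<open>V k\<close> of an
  ambient real vector space; the space itself is their direct sum.  Graded maps are
  determined by their values on homogeneous elements, and nothing is assumed about the values of
  the representing functions anywhere else.
\<close>

definition graded_space :: "(int \<Rightarrow> 'v::real_vector set) \<Rightarrow> bool" where
  "graded_space V \<longleftrightarrow> (\<forall>k. subspace (V k)) \<and>
     (\<forall>K x. finite K \<longrightarrow> (\<forall>k\<in>K. x k \<in> V k) \<longrightarrow> (\<Sum>k\<in>K. x k) = 0 \<longrightarrow> (\<forall>k\<in>K. x k = 0))"

definition homogeneous :: "(int \<Rightarrow> 'v set) \<Rightarrow> 'v set" where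
  "homogeneous V = (\<Union>k. V k)"

text \<open>
  The degree \<open>|x|\<close> is unique for homogeneous \<open>x \<noteq> 0\<close>.  For \<open>x = 0\<close> it is an unspecified integer,
  but it only ever occurs in signs multiplying terms that vanish for \<open>x = 0\<close>.
\<close>

definition degree_of :: "(int \<Rightarrow> 'v set) \<Rightarrow> 'v \<Rightarrow> int" where
  "degree_of V x = (SOME k. x \<in> V k)"

abbreviation koszul :: "int \<Rightarrow> real" where
  "koszul k \<equiv> (-1) powi k"

definition graded_linear ::
  "(int \<Rightarrow> 'v::real_vector set) \<Rightarrow> (int \<Rightarrow> 'w::real_vector set) \<Rightarrow> int \<Rightarrow> ('v \<Rightarrow> 'w) \<Rightarrow> bool" where
  "graded_linear V W d h \<longleftrightarrow> (\<forall>k. \<forall>x\<in>V k. h x \<in> W (k + d) \<and>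
     (\<forall>y\<in>V k. h (x + y) = h x + h y) \<and> (\<forall>c. h (c *\<^sub>R x) = c *\<^sub>R h x))"

definition graded_bilinear ::
  "(int \<Rightarrow> 'u::real_vector set) \<Rightarrow> (int \<Rightarrow> 'v::real_vector set) \<Rightarrow> (int \<Rightarrow> 'w::real_vector set) \<Rightarrow>
   int \<Rightarrow> ('u \<Rightarrow> 'v \<Rightarrow> 'w) \<Rightarrow> bool" where
  "graded_bilinear U V W d b \<longleftrightarrow>
     (\<forall>k. \<forall>x\<in>U k. graded_linear V W (k + d) (b x)) \<and>
     (\<forall>l. \<forall>y\<in>V l. graded_linear U W (l + d) (\<lambda>x. b x y))"


section \<open>Smooth manifolds\<close>

text \<open>
  \<open>C_k n U k f\<close>: all partial derivatives of \<open>f\<close> up to order \<open>k\<close> exist on the open subset \<open>U\<close> of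
  \<open>\<real>\<^sup>n\<close>, and those of order exactly \<open>k\<close> are continuous.
\<close>

primrec C_k :: "nat \<Rightarrow> (nat \<Rightarrow> real) set \<Rightarrow> nat \<Rightarrow> ((nat \<Rightarrow> real) \<Rightarrow> real) \<Rightarrow> bool" where
  "C_k n U 0 f \<longleftrightarrow> continuous_map (subtopology (Euclidean_space n) U) euclideanreal f"
| "C_k n U (Suc k) f \<longleftrightarrow> (\<forall>i<n. \<exists>g. C_k n U k g \<and>
     (\<forall>x\<in>U. ((\<lambda>t. f (x(i := t))) has_real_derivative g x) (at (x i))))"

definition C_infinity :: "nat \<Rightarrow> (nat \<Rightarrow> real) set \<Rightarrow> ((nat \<Rightarrow> real) \<Rightarrow> real) \<Rightarrow> bool" where
  "C_infinity n U f \<longleftrightarrow> (\<forall>k. C_k n U k f)"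

record 'p manifold =
  topo :: "'p topology"
  dimension :: nat
  atlas :: "('p set \<times> ('p \<Rightarrow> nat \<Rightarrow> real)) set"

definition smooth_manifold :: "'p manifold \<Rightarrow> bool" where
  "smooth_manifold M \<longleftrightarrow>
     Hausdorff_space (topo M) \<and> second_countable (topo M) \<and>
     \<Union>(fst ` atlas M) = topspace (topo M) \<and>
     (\<forall>(U, \<phi>)\<in>atlas M. openin (topo M) U \<and> openin (Euclidean_space (dimension M)) (\<phi> ` U) \<and>
        homeomorphic_map (subtopology (topo M) U)
          (subtopology (Euclidean_space (dimension M)) (\<phi> ` U)) \<phi>) \<and>
     (\<forall>(U, \<phi>)\<in>atlas M. \<forall>(V, \<psi>)\<in>atlas M. \<forall>i<dimension M.
        C_infinity (dimension M) (\<phi> ` (U \<inter> V)) (\<lambda>x. \<psi> (inv_into U \<phi> x) i))"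

definition smooth_function :: "'p manifold \<Rightarrow> 'p set \<Rightarrow> ('p \<Rightarrow> real) \<Rightarrow> bool" where
  "smooth_function M W f \<longleftrightarrow>
     (\<forall>(U, \<phi>)\<in>atlas M. C_infinity (dimension M) (\<phi> ` (U \<inter> W)) (f \<circ> inv_into U \<phi>))"


section \<open>Sheaves of graded algebras and modules\<close>

text \<open>
  \<open>sections F U k\<close> is the degree \<open>k\<close> part of \<open>F(U)\<close>, and \<open>restr F U V\<close> is the restriction
  \<open>F(U) \<rightarrow> F(V)\<close>.  Sheaves are sheaves of graded vector spaces, i.e. gluing takes place in each
  degree separately.
\<close>

record ('p, 'x) graded_sheaf =
  sections :: "'p set \<Rightarrow> int \<Rightarrow> 'x set"
  restr :: "'p set \<Rightarrow> 'p set \<Rightarrow> 'x \<Rightarrow> 'x"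

record ('p, 'f) algebra_sheaf = "('p, 'f) graded_sheaf" +
  times_on :: "'p set \<Rightarrow> 'f \<Rightarrow> 'f \<Rightarrow> 'f"
  unit_on :: "'p set \<Rightarrow> 'f"

record ('p, 'f, 'e) module_sheaf = "('p, 'e) graded_sheaf" +
  act_on :: "'p set \<Rightarrow> 'f \<Rightarrow> 'e \<Rightarrow> 'e"

definition sheaf_of_graded_spaces ::
  "'p topology \<Rightarrow> ('p, 'x::real_vector, 'z) graded_sheaf_scheme \<Rightarrow> bool" where
  "sheaf_of_graded_spaces T F \<longleftrightarrow>
     (\<forall>U. openin T U \<longrightarrow> graded_space (sections F U)) \<and>
     (\<forall>U V. openin T U \<longrightarrow> openin T V \<longrightarrow> V \<subseteq> U \<longrightarrow>
        graded_linear (sections F U) (sections F V) 0 (restr F U V)) \<and>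
     (\<forall>U k. openin T U \<longrightarrow> (\<forall>x\<in>sections F U k. restr F U U x = x)) \<and>
     (\<forall>U V W k. openin T U \<longrightarrow> openin T V \<longrightarrow> openin T W \<longrightarrow> W \<subseteq> V \<longrightarrow> V \<subseteq> U \<longrightarrow>
        (\<forall>x\<in>sections F U k. restr F V W (restr F U V x) = restr F U W x)) \<and>
     (\<forall>\<U> k. (\<forall>U\<in>\<U>. openin T U) \<longrightarrow>
        (\<forall>t. (\<forall>U\<in>\<U>. t U \<in> sections F U k) \<longrightarrow>
             (\<forall>U\<in>\<U>. \<forall>V\<in>\<U>. restr F U (U \<inter> V) (t U) = restr F V (U \<inter> V) (t V)) \<longrightarrow>
             (\<exists>!x. x \<in> sections F (\<Union>\<U>) k \<and> (\<forall>U\<in>\<U>. restr F (\<Union>\<U>) U x = t U))))"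

definition graded_commutative_algebra ::
  "(int \<Rightarrow> 'f::real_vector set) \<Rightarrow> ('f \<Rightarrow> 'f \<Rightarrow> 'f) \<Rightarrow> 'f \<Rightarrow> bool" where
  "graded_commutative_algebra C m u \<longleftrightarrow>
     graded_space C \<and> graded_bilinear C C C 0 m \<and> u \<in> C 0 \<and>
     (\<forall>k. \<forall>f\<in>C k. m u f = f) \<and>
     (\<forall>k l. \<forall>f\<in>C k. \<forall>g\<in>C l. m f g = koszul (k * l) *\<^sub>R m g f) \<and>
     (\<forall>k l j. \<forall>f\<in>C k. \<forall>g\<in>C l. \<forall>h\<in>C j. m (m f g) h = m f (m g h))"

definition sheaf_of_graded_algebras ::
  "'p topology \<Rightarrow> ('p, 'f::real_vector) algebra_sheaf \<Rightarrow> bool" where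
  "sheaf_of_graded_algebras T F \<longleftrightarrow>
     sheaf_of_graded_spaces T F \<and>
     (\<forall>U. openin T U \<longrightarrow>
        graded_commutative_algebra (sections F U) (times_on F U) (unit_on F U)) \<and>
     (\<forall>U V. openin T U \<longrightarrow> openin T V \<longrightarrow> V \<subseteq> U \<longrightarrow>
        restr F U V (unit_on F U) = unit_on F V \<and>
        (\<forall>k l. \<forall>f\<in>sections F U k. \<forall>g\<in>sections F U l.
           restr F U V (times_on F U f g) = times_on F V (restr F U V f) (restr F U V g)))"

definition sheaf_of_graded_modules ::
  "'p topology \<Rightarrow> ('p, 'f::real_vector) algebra_sheaf \<Rightarrow> ('p, 'f, 'e::real_vector) module_sheaf \<Rightarrow>
   bool" where
  "sheaf_of_graded_modules T F E \<longleftrightarrow>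
     sheaf_of_graded_spaces T E \<and>
     (\<forall>U. openin T U \<longrightarrow>
        graded_bilinear (sections F U) (sections E U) (sections E U) 0 (act_on E U) \<and>
        (\<forall>k. \<forall>s\<in>sections E U k. act_on E U (unit_on F U) s = s) \<and>
        (\<forall>k l j. \<forall>f\<in>sections F U k. \<forall>g\<in>sections F U l. \<forall>s\<in>sections E U j.
           act_on E U (times_on F U f g) s = act_on E U f (act_on E U g s))) \<and>
     (\<forall>U V. openin T U \<longrightarrow> openin T V \<longrightarrow> V \<subseteq> U \<longrightarrow>
        (\<forall>k l. \<forall>f\<in>sections F U k. \<forall>s\<in>sections E U l.
           restr E U V (act_on E U f s) = act_on E V (restr F U V f) (restr E U V s)))"


section \<open>Graded manifolds\<close>

text \<open>
  The graded vector space \<open>V\<close> is given by a homogeneous basis \<open>(e\<^sub>i)\<close>, \<open>i \<in> basis\<close>, with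
  \<open>|e\<^sub>i| = basis_degree i\<close>; the dual coordinate \<open>\<xi>\<^sub>i\<close> has degree \<open>- |e\<^sub>i|\<close>.  The linear order on the
  index type serves only to fix the order of the factors in a monomial
  \<open>\<xi>\<^sup>a = \<Prod>\<^sub>i \<xi>\<^sub>i\<^bsup>a i\<^esup>\<close>.
\<close>

record ('p, 'i, 'f) graded_mfd =
  base :: "'p manifold"
  basis :: "'i set"
  basis_degree :: "'i \<Rightarrow> int"
  funs :: "('p, 'f) algebra_sheaf"

text \<open>Odd coordinates square to zero, so they occur in a monomial with exponent at most one.\<close>

definition monomials ::
  "('p, 'i::linorder, 'f) graded_mfd \<Rightarrow> ('i \<Rightarrow> nat) set" where
  "monomials M = {a. finite {i. a i \<noteq> 0} \<and> {i. a i \<noteq> 0} \<subseteq> basis M \<and>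
                     (\<forall>i. odd (basis_degree M i) \<longrightarrow> a i \<le> 1)}"

definition monomial_degree ::
  "('p, 'i::linorder, 'f) graded_mfd \<Rightarrow> ('i \<Rightarrow> nat) \<Rightarrow> int" where
  "monomial_degree M a = (\<Sum>i | a i \<noteq> 0. int (a i) * (- basis_degree M i))"

text \<open>
  \<open>\<xi>\<^sup>a \<xi>\<^sup>b = \<plusminus> \<xi>\<^bsup>a+b\<^esup>\<close>: sorting the factors moves each odd \<open>\<xi>\<^sub>i\<close> of \<open>\<xi>\<^sup>b\<close> past each odd \<open>\<xi>\<^sub>j\<close> of \<open>\<xi>\<^sup>a\<close> with
  \<open>i < j\<close>.
\<close>

definition monomial_sign ::
  "('p, 'i::linorder, 'f) graded_mfd \<Rightarrow> ('i \<Rightarrow> nat) \<Rightarrow> ('i \<Rightarrow> nat) \<Rightarrow> real" where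
  "monomial_sign M a b = (-1) ^ card {(i, j). i < j \<and> b i \<noteq> 0 \<and> a j \<noteq> 0 \<and>
                                        odd (basis_degree M i) \<and> odd (basis_degree M j)}"

text \<open>
  The local model over an open \<open>W \<subseteq> M\<close>: an element \<open>\<Sum>\<^sub>a c\<^sub>a \<xi>\<^sup>a\<close> of the completed tensor product of
  \<open>C\<^sup>\<infinity>(W)\<close> with the formal polynomials on \<open>V\<close> is the family of its coefficients \<open>c a\<close>, which
  are smooth on \<open>W\<close> and extended by zero outside \<open>W\<close>.
\<close>

type_synonym ('p, 'i) formal = "('i \<Rightarrow> nat) \<Rightarrow> 'p \<Rightarrow> real"

definition model_sections ::
  "('p, 'i::linorder, 'f) graded_mfd \<Rightarrow> 'p set \<Rightarrow> int \<Rightarrow> ('p, 'i) formal set" where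
  "model_sections M W k = {c. \<forall>a. smooth_function (base M) W (c a) \<and> (\<forall>p. p \<notin> W \<longrightarrow> c a p = 0) \<and>
     (\<not> (a \<in> monomials M \<and> monomial_degree M a = k) \<longrightarrow> c a = (\<lambda>_. 0))}"

definition model_restr :: "'p set \<Rightarrow> ('p, 'i) formal \<Rightarrow> ('p, 'i) formal" where
  "model_restr W c = (\<lambda>a p. if p \<in> W then c a p else 0)"

definition model_one :: "'p set \<Rightarrow> ('p, 'i) formal" where
  "model_one W = (\<lambda>a p. if a = (\<lambda>_. 0) \<and> p \<in> W then 1 else 0)"

definition model_times ::
  "('p, 'i::linorder, 'f) graded_mfd \<Rightarrow> ('p, 'i) formal \<Rightarrow> ('p, 'i) formal \<Rightarrow> ('p, 'i) formal" where
  "model_times M c c' = (\<lambda>m p. if m \<in> monomials M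
     then \<Sum>a | a \<le> m. monomial_sign M a (\<lambda>i. m i - a i) * c a p * c' (\<lambda>i. m i - a i) p
     else 0)"

definition local_isomorphism ::
  "('p, 'i::linorder, 'f::real_vector) graded_mfd \<Rightarrow> 'p set \<Rightarrow> ('p set \<Rightarrow> 'f \<Rightarrow> ('p, 'i) formal) \<Rightarrow>
   bool" where
  "local_isomorphism M U h \<longleftrightarrow>
     (\<forall>W. openin (topo (base M)) W \<longrightarrow> W \<subseteq> U \<longrightarrow>
        (\<forall>k. bij_betw (h W) (sections (funs M) W k) (model_sections M W k) \<and>
           (\<forall>f\<in>sections (funs M) W k.
              (\<forall>g\<in>sections (funs M) W k. h W (f + g) = (\<lambda>a p. h W f a p + h W g a p)) \<and>
              (\<forall>r. h W (r *\<^sub>R f) = (\<lambda>a p. r * h W f a p)) \<and>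
              (\<forall>l. \<forall>g\<in>sections (funs M) W l.
                 h W (times_on (funs M) W f g) = model_times M (h W f) (h W g)) \<and>
              (\<forall>W'. openin (topo (base M)) W' \<longrightarrow> W' \<subseteq> W \<longrightarrow>
                 h W' (restr (funs M) W W' f) = model_restr W' (h W f)))) \<and>
        h W (unit_on (funs M) W) = model_one W)"

definition graded_manifold :: "('p, 'i::linorder, 'f::real_vector) graded_mfd \<Rightarrow> bool" where
  "graded_manifold M \<longleftrightarrow>
     smooth_manifold (base M) \<and>
     sheaf_of_graded_algebras (topo (base M)) (funs M) \<and>
     (\<forall>p\<in>topspace (topo (base M)).
        \<exists>U h. openin (topo (base M)) U \<and> p \<in> U \<and> local_isomorphism M U h)"

abbreviation points :: "('p, 'i, 'f) graded_mfd \<Rightarrow> 'p set" where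
  "points M \<equiv> topspace (topo (base M))"

text \<open>The graded algebra \<open>C\<^sup>\<infinity>(M)\<close> of global sections.\<close>

abbreviation Cinf :: "('p, 'i, 'f) graded_mfd \<Rightarrow> int \<Rightarrow> 'f set" where
  "Cinf M \<equiv> sections (funs M) (points M)"

abbreviation fmult :: "('p, 'i, 'f) graded_mfd \<Rightarrow> 'f \<Rightarrow> 'f \<Rightarrow> 'f" where
  "fmult M \<equiv> times_on (funs M) (points M)"

text \<open>Graded derivations of \<open>C\<^sup>\<infinity>(M)\<close> of degree \<open>d\<close>, i.e. vector fields, and their graded commutator.\<close>

definition vector_field ::
  "('p, 'i, 'f::real_vector) graded_mfd \<Rightarrow> int \<Rightarrow> ('f \<Rightarrow> 'f) \<Rightarrow> bool" where
  "vector_field M d D \<longleftrightarrow> graded_linear (Cinf M) (Cinf M) d D \<and>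
     (\<forall>k l. \<forall>f\<in>Cinf M k. \<forall>g\<in>Cinf M l.
        D (fmult M f g) = fmult M (D f) g + koszul (d * k) *\<^sub>R fmult M f (D g))"

definition commutator ::
  "int \<Rightarrow> ('f \<Rightarrow> 'f) \<Rightarrow> int \<Rightarrow> ('f \<Rightarrow> 'f) \<Rightarrow> 'f::real_vector \<Rightarrow> 'f" where
  "commutator d D d' D' f = D (D' f) - koszul (d * d') *\<^sub>R D' (D f)"

definition dg_manifold ::
  "('p, 'i::linorder, 'f::real_vector) graded_mfd \<Rightarrow> ('f \<Rightarrow> 'f) \<Rightarrow> bool" where
  "dg_manifold M Q \<longleftrightarrow> graded_manifold M \<and> vector_field M 1 Q \<and>
     (\<forall>k. \<forall>f\<in>Cinf M k. commutator 1 Q 1 Q f = 0)"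


section \<open>Dg-vector bundles and dg-Lie algebroids\<close>

text \<open>
  A vector bundle over a graded manifold is given by its sheaf of sections, a sheaf of graded
  modules with finite homogeneous local frames \<open>e 0, \<dots>, e (n - 1)\<close>, \<open>|e j| = w j\<close>.
\<close>

definition local_frame ::
  "('p, 'i, 'f::real_vector) graded_mfd \<Rightarrow> ('p, 'f, 'e::real_vector) module_sheaf \<Rightarrow> 'p set \<Rightarrow>
   nat \<Rightarrow> (nat \<Rightarrow> int) \<Rightarrow> (nat \<Rightarrow> 'e) \<Rightarrow> bool" where
  "local_frame M E U n w e \<longleftrightarrow>
     (\<forall>j<n. e j \<in> sections E U (w j)) \<and>
     (\<forall>W k. openin (topo (base M)) W \<longrightarrow> W \<subseteq> U \<longrightarrow>
        (\<forall>s\<in>sections E W k. \<exists>!f. (\<forall>j<n. f j \<in> sections (funs M) W (k - w j)) \<and>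
           (\<forall>j\<ge>n. f j = 0) \<and> s = (\<Sum>j<n. act_on E W (f j) (restr E U W (e j)))))"

definition vector_bundle ::
  "('p, 'i, 'f::real_vector) graded_mfd \<Rightarrow> ('p, 'f, 'e::real_vector) module_sheaf \<Rightarrow> bool" where
  "vector_bundle M E \<longleftrightarrow>
     sheaf_of_graded_modules (topo (base M)) (funs M) E \<and>
     (\<forall>p\<in>points M. \<exists>U n w e. openin (topo (base M)) U \<and> p \<in> U \<and> local_frame M E U n w e)"

abbreviation \<Gamma> ::
  "('p, 'i, 'f) graded_mfd \<Rightarrow> ('p, 'f, 'e) module_sheaf \<Rightarrow> int \<Rightarrow> 'e set" where
  "\<Gamma> M E \<equiv> sections E (points M)"

abbreviation smult ::
  "('p, 'i, 'f) graded_mfd \<Rightarrow> ('p, 'f, 'e) module_sheaf \<Rightarrow> 'f \<Rightarrow> 'e \<Rightarrow> 'e" where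
  "smult M E \<equiv> act_on E (points M)"

definition dg_vector_bundle ::
  "('p, 'i, 'f::real_vector) graded_mfd \<Rightarrow> ('f \<Rightarrow> 'f) \<Rightarrow>
   ('p, 'f, 'e::real_vector) module_sheaf \<Rightarrow> ('e \<Rightarrow> 'e) \<Rightarrow> bool" where
  "dg_vector_bundle M Q E QE \<longleftrightarrow>
     vector_bundle M E \<and>
     graded_linear (\<Gamma> M E) (\<Gamma> M E) 1 QE \<and>
     (\<forall>k. \<forall>s\<in>\<Gamma> M E k. QE (QE s) = 0) \<and>
     (\<forall>k l. \<forall>f\<in>Cinf M k. \<forall>s\<in>\<Gamma> M E l.
        QE (smult M E f s) = smult M E (Q f) s + koszul k *\<^sub>R smult M E f (QE s))"

definition graded_lie_algebroid ::
  "('p, 'i, 'f::real_vector) graded_mfd \<Rightarrow> ('p, 'f, 'a::real_vector) module_sheaf \<Rightarrow>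
   ('a \<Rightarrow> 'a \<Rightarrow> 'a) \<Rightarrow> ('a \<Rightarrow> 'f \<Rightarrow> 'f) \<Rightarrow> bool" where
  "graded_lie_algebroid M A br \<rho> \<longleftrightarrow>
     vector_bundle M A \<and>
     graded_bilinear (\<Gamma> M A) (\<Gamma> M A) (\<Gamma> M A) 0 br \<and>
     (\<forall>k l. \<forall>X\<in>\<Gamma> M A k. \<forall>Y\<in>\<Gamma> M A l. br X Y = - (koszul (k * l) *\<^sub>R br Y X)) \<and>
     (\<forall>k l j. \<forall>X\<in>\<Gamma> M A k. \<forall>Y\<in>\<Gamma> M A l. \<forall>Z\<in>\<Gamma> M A j.
        br X (br Y Z) = br (br X Y) Z + koszul (k * l) *\<^sub>R br Y (br X Z)) \<and>
     graded_bilinear (\<Gamma> M A) (Cinf M) (Cinf M) 0 \<rho> \<and>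
     (\<forall>k. \<forall>X\<in>\<Gamma> M A k. vector_field M k (\<rho> X)) \<and>
     (\<forall>k l j. \<forall>f\<in>Cinf M k. \<forall>X\<in>\<Gamma> M A l. \<forall>g\<in>Cinf M j.
        \<rho> (smult M A f X) g = fmult M f (\<rho> X g)) \<and>
     (\<forall>k l j. \<forall>X\<in>\<Gamma> M A k. \<forall>Y\<in>\<Gamma> M A l. \<forall>g\<in>Cinf M j.
        \<rho> (br X Y) g = commutator k (\<rho> X) l (\<rho> Y) g) \<and>
     (\<forall>k l j. \<forall>X\<in>\<Gamma> M A k. \<forall>f\<in>Cinf M l. \<forall>Y\<in>\<Gamma> M A j.
        br X (smult M A f Y) = smult M A (\<rho> X f) Y + koszul (k * l) *\<^sub>R smult M A f (br X Y))"

definition dg_lie_algebroid ::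
  "('p, 'i, 'f::real_vector) graded_mfd \<Rightarrow> ('f \<Rightarrow> 'f) \<Rightarrow>
   ('p, 'f, 'a::real_vector) module_sheaf \<Rightarrow> ('a \<Rightarrow> 'a) \<Rightarrow>
   ('a \<Rightarrow> 'a \<Rightarrow> 'a) \<Rightarrow> ('a \<Rightarrow> 'f \<Rightarrow> 'f) \<Rightarrow> bool" where
  "dg_lie_algebroid M Q A QA br \<rho> \<longleftrightarrow>
     dg_vector_bundle M Q A QA \<and> graded_lie_algebroid M A br \<rho> \<and>
     (\<forall>k l. \<forall>X\<in>\<Gamma> M A k. \<forall>Y\<in>\<Gamma> M A l. QA (br X Y) = br (QA X) Y + koszul k *\<^sub>R br X (QA Y)) \<and>
     (\<forall>k l. \<forall>X\<in>\<Gamma> M A k. \<forall>f\<in>Cinf M l. \<rho> (QA X) f = commutator 1 Q k (\<rho> X) f)"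

definition lie_connection ::
  "('p, 'i, 'f::real_vector) graded_mfd \<Rightarrow> ('p, 'f, 'a::real_vector) module_sheaf \<Rightarrow>
   ('a \<Rightarrow> 'f \<Rightarrow> 'f) \<Rightarrow> ('p, 'f, 'e::real_vector) module_sheaf \<Rightarrow> ('a \<Rightarrow> 'e \<Rightarrow> 'e) \<Rightarrow> bool" where
  "lie_connection M A \<rho> E nabla \<longleftrightarrow>
     graded_bilinear (\<Gamma> M A) (\<Gamma> M E) (\<Gamma> M E) 0 nabla \<and>
     (\<forall>k l j. \<forall>f\<in>Cinf M k. \<forall>X\<in>\<Gamma> M A l. \<forall>s\<in>\<Gamma> M E j.
        nabla (smult M A f X) s = smult M E f (nabla X s) \<and>
        nabla X (smult M E f s) =
          smult M E (\<rho> X f) s + koszul (l * k) *\<^sub>R smult M E f (nabla X s))"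


section \<open>The complex of sections of the bundle of maps from A (x) E to E\<close>

text \<open>
  A degree \<open>d\<close> section of \<open>A\<^sup>\<or> \<otimes> End E\<close> is a graded \<open>C\<^sup>\<infinity>(M)\<close>-bilinear map
  \<open>\<Gamma>(A) \<times> \<Gamma>(E) \<rightarrow> \<Gamma>(E)\<close> of degree \<open>d\<close>.  As only values on homogeneous elements
  matter, the representing function is normalised to be zero elsewhere, so that equality of
  sections is equality of functions.
\<close>

definition bundle_map ::
  "('p, 'i, 'f::real_vector) graded_mfd \<Rightarrow> ('p, 'f, 'a::real_vector) module_sheaf \<Rightarrow>
   ('p, 'f, 'e::real_vector) module_sheaf \<Rightarrow> int \<Rightarrow> ('a \<Rightarrow> 'e \<Rightarrow> 'e) \<Rightarrow> bool" where
  "bundle_map M A E d \<Phi> \<longleftrightarrow>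
     graded_bilinear (\<Gamma> M A) (\<Gamma> M E) (\<Gamma> M E) d \<Phi> \<and>
     (\<forall>k l j. \<forall>f\<in>Cinf M k. \<forall>X\<in>\<Gamma> M A l. \<forall>s\<in>\<Gamma> M E j.
        \<Phi> (smult M A f X) s = koszul (d * k) *\<^sub>R smult M E f (\<Phi> X s) \<and>
        \<Phi> (smult M A f X) s = koszul (k * l) *\<^sub>R \<Phi> X (smult M E f s))"

definition on_homogeneous ::
  "(int \<Rightarrow> 'a set) \<Rightarrow> (int \<Rightarrow> 'e set) \<Rightarrow> ('a \<Rightarrow> 'e \<Rightarrow> 'e::zero) \<Rightarrow> 'a \<Rightarrow> 'e \<Rightarrow> 'e" where
  "on_homogeneous V W \<Phi> =
     (\<lambda>X s. if X \<in> homogeneous V \<and> s \<in> homogeneous W then \<Phi> X s else 0)"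

definition hom_sections ::
  "('p, 'i, 'f::real_vector) graded_mfd \<Rightarrow> ('p, 'f, 'a::real_vector) module_sheaf \<Rightarrow>
   ('p, 'f, 'e::real_vector) module_sheaf \<Rightarrow> int \<Rightarrow> ('a \<Rightarrow> 'e \<Rightarrow> 'e) set" where
  "hom_sections M A E d = {\<Phi>. bundle_map M A E d \<Phi> \<and> on_homogeneous (\<Gamma> M A) (\<Gamma> M E) \<Phi> = \<Phi>}"

text \<open>\<open>hom_differential M A QA E QE d\<close> is the operator \<open>Q\<close> on sections of degree \<open>d\<close>.\<close>

definition hom_differential ::
  "('p, 'i, 'f) graded_mfd \<Rightarrow> ('p, 'f, 'a) module_sheaf \<Rightarrow> ('a \<Rightarrow> 'a) \<Rightarrow>
   ('p, 'f, 'e::real_vector) module_sheaf \<Rightarrow> ('e \<Rightarrow> 'e) \<Rightarrow> int \<Rightarrow>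
   ('a \<Rightarrow> 'e \<Rightarrow> 'e) \<Rightarrow> ('a \<Rightarrow> 'e \<Rightarrow> 'e)" where
  "hom_differential M A QA E QE d \<Phi> = on_homogeneous (\<Gamma> M A) (\<Gamma> M E)
     (\<lambda>X s. QE (\<Phi> X s) - koszul d *\<^sub>R \<Phi> (QA X) s
              - koszul (d + degree_of (\<Gamma> M A) X) *\<^sub>R \<Phi> X (QE s))"

definition cocycles ::
  "('p, 'i, 'f::real_vector) graded_mfd \<Rightarrow> ('p, 'f, 'a::real_vector) module_sheaf \<Rightarrow> ('a \<Rightarrow> 'a) \<Rightarrow>
   ('p, 'f, 'e::real_vector) module_sheaf \<Rightarrow> ('e \<Rightarrow> 'e) \<Rightarrow> int \<Rightarrow> ('a \<Rightarrow> 'e \<Rightarrow> 'e) set" where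
  "cocycles M A QA E QE d =
     {\<Phi> \<in> hom_sections M A E d. hom_differential M A QA E QE d \<Phi> = (\<lambda>X s. 0)}"

definition cohomologous ::
  "('p, 'i, 'f::real_vector) graded_mfd \<Rightarrow> ('p, 'f, 'a::real_vector) module_sheaf \<Rightarrow> ('a \<Rightarrow> 'a) \<Rightarrow>
   ('p, 'f, 'e::real_vector) module_sheaf \<Rightarrow> ('e \<Rightarrow> 'e) \<Rightarrow> int \<Rightarrow>
   (('a \<Rightarrow> 'e \<Rightarrow> 'e) \<times> ('a \<Rightarrow> 'e \<Rightarrow> 'e)) set" where
  "cohomologous M A QA E QE d =
     {(\<Phi>, \<Phi>'). \<Phi> \<in> cocycles M A QA E QE d \<and> \<Phi>' \<in> cocycles M A QA E QE d \<and>
        (\<exists>\<Psi>\<in>hom_sections M A E (d - 1).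
           (\<lambda>X s. \<Phi> X s - \<Phi>' X s) = hom_differential M A QA E QE (d - 1) \<Psi>)}"

definition cohomology ::
  "('p, 'i, 'f::real_vector) graded_mfd \<Rightarrow> ('p, 'f, 'a::real_vector) module_sheaf \<Rightarrow> ('a \<Rightarrow> 'a) \<Rightarrow>
   ('p, 'f, 'e::real_vector) module_sheaf \<Rightarrow> ('e \<Rightarrow> 'e) \<Rightarrow> int \<Rightarrow> ('a \<Rightarrow> 'e \<Rightarrow> 'e) set set" where
  "cohomology M A QA E QE d = cocycles M A QA E QE d // cohomologous M A QA E QE d"

definition cohomology_class ::
  "('p, 'i, 'f::real_vector) graded_mfd \<Rightarrow> ('p, 'f, 'a::real_vector) module_sheaf \<Rightarrow> ('a \<Rightarrow> 'a) \<Rightarrow>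
   ('p, 'f, 'e::real_vector) module_sheaf \<Rightarrow> ('e \<Rightarrow> 'e) \<Rightarrow> int \<Rightarrow>
   ('a \<Rightarrow> 'e \<Rightarrow> 'e) \<Rightarrow> ('a \<Rightarrow> 'e \<Rightarrow> 'e) set" where
  "cohomology_class M A QA E QE d \<Phi> = cohomologous M A QA E QE d `` {\<Phi>}"

definition atiyah ::
  "('p, 'i, 'f) graded_mfd \<Rightarrow> ('p, 'f, 'a) module_sheaf \<Rightarrow> ('a \<Rightarrow> 'a) \<Rightarrow>
   ('p, 'f, 'e::real_vector) module_sheaf \<Rightarrow> ('e \<Rightarrow> 'e) \<Rightarrow>
   ('a \<Rightarrow> 'e \<Rightarrow> 'e) \<Rightarrow> ('a \<Rightarrow> 'e \<Rightarrow> 'e)" where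
  "atiyah M A QA E QE nabla = on_homogeneous (\<Gamma> M A) (\<Gamma> M E)
     (\<lambda>X s. QE (nabla X s) - nabla (QA X) s
              - koszul (degree_of (\<Gamma> M A) X) *\<^sub>R nabla X (QE s))"

end

theory Submission
  imports Defs
begin

text \<open>
  Up to notation, the Atiyah map is the differential of the connection \<open>\<nabla>\<close> itself, regarded as a
  degree \<open>0\<close> graded bilinear map over \<open>\<real>\<close>.  The operator \<open>Q\<close> squares to zero on all such maps, not
  only on the \<open>C\<^sup>\<infinity>(M)\<close>-bilinear ones, which gives the cocycle property.  Two connections differ by a
  \<open>C\<^sup>\<infinity>(M)\<close>-bilinear map \<open>\<Psi>\<close> of degree \<open>0\<close>, and their Atiyah maps differ by \<open>Q \<Psi>\<close>.
\<close>

section \<open>Koszul signs and graded linear algebra over the reals\<close>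

lemma koszul_cases: "koszul k = 1 \<or> koszul k = -1"
  by (cases "even k") (auto simp: power_int_minus_left)

lemma koszul_add: "koszul (k + l) = koszul k * koszul l"
  by (simp add: power_int_add)

lemma graded_spaceD:
  assumes "graded_space V"
  shows "subspace (V k)"
  using assms by (simp add: graded_space_def)

text \<open>If the degrees differed, \<open>x\<close> in one component and \<open>- x\<close> in the
  other would form a vanishing sum of homogeneous elements that are not all zero, against the
  independence of the components.\<close>

lemma graded_space_degree_unique:
  assumes V: "graded_space V" and x: "x \<in> V k" "x \<in> V l" "x \<noteq> 0"
  shows "k = l"
proof (rule ccontr)
  assume "k \<noteq> l"
  define y where "y j = (if j = k then x else - x)" for j
  have "- x \<in> V l"
    using graded_spaceD[OF V] x(2) by (rule subspace_neg)
  then have "\<forall>j\<in>{k, l}. y j \<in> V j"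
    using x(1) by (auto simp: y_def)
  moreover have "(\<Sum>j\<in>{k, l}. y j) = 0"
    using \<open>k \<noteq> l\<close> by (simp add: y_def)
  moreover have "finite {k, l} \<longrightarrow> (\<forall>j\<in>{k, l}. y j \<in> V j) \<longrightarrow> (\<Sum>j\<in>{k, l}. y j) = 0 \<longrightarrow>
      (\<forall>j\<in>{k, l}. y j = 0)"
    using V[unfolded graded_space_def, THEN conjunct2] by (elim allE)
  ultimately have "\<forall>j\<in>{k, l}. y j = 0"
    by blast
  then show False
    using \<open>x \<noteq> 0\<close> by (simp add: y_def)
qed

lemma degree_of_eq:
  assumes "graded_space V" "x \<in> V k" "x \<noteq> 0"
  shows "degree_of V x = k"
proof (rule graded_space_degree_unique[OF assms(1) _ assms(2,3)])
  show "x \<in> V (degree_of V x)"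
    unfolding degree_of_def using assms(2) by (rule someI)
qed

lemma homogeneousI: "x \<in> V k \<Longrightarrow> x \<in> homogeneous V"
  by (auto simp: homogeneous_def)

lemma homogeneousE:
  assumes "x \<in> homogeneous V"
  obtains k where "x \<in> V k"
  using assms by (auto simp: homogeneous_def)

lemma graded_linear_mem: "graded_linear V W d h \<Longrightarrow> x \<in> V k \<Longrightarrow> h x \<in> W (k + d)"
  by (simp add: graded_linear_def)

lemma graded_linear_add:
  "graded_linear V W d h \<Longrightarrow> x \<in> V k \<Longrightarrow> y \<in> V k \<Longrightarrow> h (x + y) = h x + h y"
  by (simp add: graded_linear_def)

lemma graded_linear_scaleR:
  "graded_linear V W d h \<Longrightarrow> x \<in> V k \<Longrightarrow> h (c *\<^sub>R x) = c *\<^sub>R h x"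
  by (simp add: graded_linear_def)

lemma graded_linear_diff:
  assumes "graded_space V" "graded_linear V W d h" "x \<in> V k" "y \<in> V k"
  shows "h (x - y) = h x - h y"
proof -
  have "(-1) *\<^sub>R y \<in> V k"
    using graded_spaceD[OF assms(1)] assms(4) by (rule subspace_scale)
  then have "h (x + (-1) *\<^sub>R y) = h x + (-1) *\<^sub>R h y"
    by (simp only: graded_linear_add[OF assms(2,3)] graded_linear_scaleR[OF assms(2,4)])
  then show ?thesis by simp
qed

lemma graded_linear_zero:
  assumes "graded_space V" "graded_linear V W d h"
  shows "h 0 = 0"
  using graded_linear_diff[OF assms, of 0 0 0] subspace_0[OF graded_spaceD[OF assms(1)]] by simp

lemma graded_bilinear_left:
  "graded_bilinear U V W d b \<Longrightarrow> y \<in> V l \<Longrightarrow> graded_linear U W (l + d) (\<lambda>x. b x y)"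
  by (simp add: graded_bilinear_def)

lemma graded_bilinear_right:
  "graded_bilinear U V W d b \<Longrightarrow> x \<in> U k \<Longrightarrow> graded_linear V W (k + d) (b x)"
  by (simp add: graded_bilinear_def)

lemma graded_bilinear_mem:
  assumes "graded_bilinear U V W d b" "x \<in> U k" "y \<in> V l"
  shows "b x y \<in> W (k + l + d)"
  using graded_linear_mem[OF graded_bilinear_left[OF assms(1,3)] assms(2)] by (simp add: add.assoc)

lemmas graded_bilinear_add_left = graded_linear_add[OF graded_bilinear_left]
  and graded_bilinear_add_right = graded_linear_add[OF graded_bilinear_right]
  and graded_bilinear_scaleR_left = graded_linear_scaleR[OF graded_bilinear_left]
  and graded_bilinear_scaleR_right = graded_linear_scaleR[OF graded_bilinear_right]

text \<open>The definition records the degree of \<open>b x y\<close> twice, once for each argument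
  held fixed and with different bracketings of the sum. Here one membership condition serves
  both.\<close>

lemma graded_bilinearI:
  assumes "\<And>k l x y. x \<in> U k \<Longrightarrow> y \<in> V l \<Longrightarrow> b x y \<in> W (k + l + d)"
    and "\<And>k l x x' y. x \<in> U k \<Longrightarrow> x' \<in> U k \<Longrightarrow> y \<in> V l \<Longrightarrow> b (x + x') y = b x y + b x' y"
    and "\<And>k l x y y'. x \<in> U k \<Longrightarrow> y \<in> V l \<Longrightarrow> y' \<in> V l \<Longrightarrow> b x (y + y') = b x y + b x y'"
    and "\<And>k l x y c. x \<in> U k \<Longrightarrow> y \<in> V l \<Longrightarrow> b (c *\<^sub>R x) y = c *\<^sub>R b x y"
    and "\<And>k l x y c. x \<in> U k \<Longrightarrow> y \<in> V l \<Longrightarrow> b x (c *\<^sub>R y) = c *\<^sub>R b x y"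
  shows "graded_bilinear U V W d b"
  unfolding graded_bilinear_def graded_linear_def
proof (intro conjI allI ballI)
  show "b x y \<in> W (l + (k + d))" if "x \<in> U k" "y \<in> V l" for k l x y
    using assms(1)[OF that] by (simp add: ac_simps)
  show "b x y \<in> W (k + (l + d))" if "y \<in> V l" "x \<in> U k" for k l x y
    using assms(1)[OF that(2,1)] by (simp add: ac_simps)
qed (erule (2) assms(2-3) | erule (1) assms(4-5) | rule assms(2)[rotated])+

lemma graded_bilinear_diff:
  assumes W: "graded_space W" and b: "graded_bilinear U V W d b" and c: "graded_bilinear U V W d c"
  shows "graded_bilinear U V W d (\<lambda>x y. b x y - c x y)"
proof (rule graded_bilinearI, goal_cases)
  case (1 k l x y)
  then show ?case
    by (intro subspace_diff graded_spaceD[OF W] graded_bilinear_mem[OF b] graded_bilinear_mem[OF c])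
qed (simp_all add: graded_bilinear_add_left[OF b] graded_bilinear_add_left[OF c]
    graded_bilinear_add_right[OF b] graded_bilinear_add_right[OF c]
    graded_bilinear_scaleR_left[OF b] graded_bilinear_scaleR_left[OF c]
    graded_bilinear_scaleR_right[OF b] graded_bilinear_scaleR_right[OF c] scaleR_diff_right)

section \<open>Normalisation of maps outside homogeneous arguments\<close>

lemma on_homogeneous_apply:
  "x \<in> V k \<Longrightarrow> y \<in> W l \<Longrightarrow> on_homogeneous V W b x y = b x y"
  by (auto simp: on_homogeneous_def intro: homogeneousI)

lemma on_homogeneous_cong:
  assumes "\<And>k l x y. x \<in> V k \<Longrightarrow> y \<in> W l \<Longrightarrow> b x y = c x y"
  shows "on_homogeneous V W b = on_homogeneous V W c"
proof (intro ext)
  fix x y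
  show "on_homogeneous V W b x y = on_homogeneous V W c x y"
    by (auto simp: on_homogeneous_def elim!: homogeneousE intro: assms)
qed

lemma on_homogeneous_idem:
  "on_homogeneous V W (on_homogeneous V W b) = on_homogeneous V W b"
  by (simp add: on_homogeneous_def fun_eq_iff)

lemma on_homogeneous_zero: "on_homogeneous V W (\<lambda>x y. 0) = (\<lambda>x y. 0)"
  by (simp add: on_homogeneous_def)

lemma on_homogeneous_diff:
  fixes b c :: "'a \<Rightarrow> 'e \<Rightarrow> 'e::group_add"
  shows "on_homogeneous V W (\<lambda>x y. b x y - c x y) =
    (\<lambda>x y. on_homogeneous V W b x y - on_homogeneous V W c x y)"
  by (simp add: on_homogeneous_def fun_eq_iff)

text \<open>Normalised maps vanish together off the homogeneous elements, so equality as functions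
  reduces to a computation with arguments of known degree. The identities for \<open>D\<close> below
  are proved this way.\<close>

lemma on_homogeneous_eqI:
  assumes "on_homogeneous V W b = b" "on_homogeneous V W c = c"
    and "\<And>k l x y. x \<in> V k \<Longrightarrow> y \<in> W l \<Longrightarrow> b x y = c x y"
  shows "b = c"
  using on_homogeneous_cong[of V W b c] assms by simp

lemma vector_bundle_sections:
  assumes "vector_bundle M E"
  shows "graded_space (\<Gamma> M E)" "graded_bilinear (Cinf M) (\<Gamma> M E) (\<Gamma> M E) 0 (smult M E)"
proof -
  have sheaf: "sheaf_of_graded_modules (topo (base M)) (funs M) E"
    using assms unfolding vector_bundle_def by (rule conjunct1)
  note modules = sheaf[unfolded sheaf_of_graded_modules_def]
  note spaces = modules[THEN conjunct1, unfolded sheaf_of_graded_spaces_def]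
  show "graded_space (\<Gamma> M E)"
    by (rule spaces[THEN conjunct1, THEN spec, THEN mp, OF openin_topspace])
  show "graded_bilinear (Cinf M) (\<Gamma> M E) (\<Gamma> M E) 0 (smult M E)"
    by (rule modules[THEN conjunct2, THEN conjunct1, THEN spec, THEN mp, OF openin_topspace,
          THEN conjunct1])
qed

section \<open>The differential on graded bilinear maps between two dg-vector bundles\<close>

locale dg_vector_bundles =
  fixes M :: "('p, 'i::linorder, 'f::real_vector) graded_mfd"
    and Q :: "'f \<Rightarrow> 'f"
    and A :: "('p, 'f, 'a::real_vector) module_sheaf"
    and QA :: "'a \<Rightarrow> 'a"
    and E :: "('p, 'f, 'e::real_vector) module_sheaf"
    and QE :: "'e \<Rightarrow> 'e"
  assumes dg_A: "dg_vector_bundle M Q A QA"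
    and dg_E: "dg_vector_bundle M Q E QE"
begin

abbreviation D :: "int \<Rightarrow> ('a \<Rightarrow> 'e \<Rightarrow> 'e) \<Rightarrow> 'a \<Rightarrow> 'e \<Rightarrow> 'e" where
  "D \<equiv> hom_differential M A QA E QE"

text \<open>Bilinearity is over the reals only. This makes a connection a cochain of degree 0,
  although its Leibniz rule prevents it in general from being linear over functions.\<close>

abbreviation bilin :: "int \<Rightarrow> ('a \<Rightarrow> 'e \<Rightarrow> 'e) \<Rightarrow> bool" where
  "bilin \<equiv> graded_bilinear (\<Gamma> M A) (\<Gamma> M E) (\<Gamma> M E)"

lemmas on_homogeneous_sections = on_homogeneous_apply[of _ "\<Gamma> M A" _ _ "\<Gamma> M E"]

lemma graded_space_A: "graded_space (\<Gamma> M A)" and graded_space_E: "graded_space (\<Gamma> M E)"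
  and smult_A: "graded_bilinear (Cinf M) (\<Gamma> M A) (\<Gamma> M A) 0 (smult M A)"
  and smult_E: "graded_bilinear (Cinf M) (\<Gamma> M E) (\<Gamma> M E) 0 (smult M E)"
  using dg_A[unfolded dg_vector_bundle_def, THEN conjunct1]
    dg_E[unfolded dg_vector_bundle_def, THEN conjunct1]
  by (simp_all only: vector_bundle_sections)

lemma subspace_A: "subspace (\<Gamma> M A k)" and subspace_E: "subspace (\<Gamma> M E k)"
  by (rule graded_spaceD[OF graded_space_A], rule graded_spaceD[OF graded_space_E])

lemma QA_linear: "graded_linear (\<Gamma> M A) (\<Gamma> M A) 1 QA"
  and QE_linear: "graded_linear (\<Gamma> M E) (\<Gamma> M E) 1 QE"
  and QA_QA: "X \<in> \<Gamma> M A k \<Longrightarrow> QA (QA X) = 0"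
  and QE_QE: "s \<in> \<Gamma> M E k \<Longrightarrow> QE (QE s) = 0"
  and QA_smult: "f \<in> Cinf M k \<Longrightarrow> X \<in> \<Gamma> M A l \<Longrightarrow>
    QA (smult M A f X) = smult M A (Q f) X + koszul k *\<^sub>R smult M A f (QA X)"
  and QE_smult: "f \<in> Cinf M k \<Longrightarrow> s \<in> \<Gamma> M E l \<Longrightarrow>
    QE (smult M E f s) = smult M E (Q f) s + koszul k *\<^sub>R smult M E f (QE s)"
  using dg_A dg_E by (simp_all add: dg_vector_bundle_def)

lemmas QA_mem = graded_linear_mem[OF QA_linear]
  and QA_add = graded_linear_add[OF QA_linear]
  and QA_scaleR = graded_linear_scaleR[OF QA_linear]
  and QE_mem = graded_linear_mem[OF QE_linear]
  and QE_add = graded_linear_add[OF QE_linear]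
  and QE_diff = graded_linear_diff[OF graded_space_E QE_linear]
  and QE_scaleR = graded_linear_scaleR[OF QE_linear]

lemma bilin_zero:
  assumes "bilin d \<Phi>"
  shows "s \<in> \<Gamma> M E l \<Longrightarrow> \<Phi> 0 s = 0" and "X \<in> \<Gamma> M A k \<Longrightarrow> \<Phi> X 0 = 0"
  using graded_linear_zero[OF graded_space_A graded_bilinear_left[OF assms]]
    graded_linear_zero[OF graded_space_E graded_bilinear_right[OF assms]] by auto

text \<open>The degree chosen by \<open>degree_of\<close> agrees with \<open>k\<close> unless
  \<open>X = 0\<close>. In that case the sign it determines multiplies \<Phi> 0
  (\<open>QE s\<close>) = 0, so \<open>k\<close> may be used in its place.\<close>

lemma hom_differential_apply:
  assumes \<Phi>: "bilin d \<Phi>" and X: "X \<in> \<Gamma> M A k" and s: "s \<in> \<Gamma> M E l"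
  shows "D d \<Phi> X s = QE (\<Phi> X s) - koszul d *\<^sub>R \<Phi> (QA X) s - koszul (d + k) *\<^sub>R \<Phi> X (QE s)"
proof (cases "X = 0")
  case True
  then have "\<Phi> X (QE s) = 0"
    using bilin_zero(1)[OF \<Phi> QE_mem[OF s]] by simp
  then show ?thesis
    using X s by (simp add: hom_differential_def on_homogeneous_apply)
next
  case False
  then show ?thesis
    using X s degree_of_eq[OF graded_space_A X]
    by (simp add: hom_differential_def on_homogeneous_apply)
qed

text \<open>Here the connection becomes a cochain of degree 0: with \<open>d = 0\<close> the sign
  \<open>koszul d\<close> is 1 and both formulas coincide.\<close>

lemma atiyah_eq: "atiyah M A QA E QE nabla = D 0 nabla"
  by (simp add: atiyah_def hom_differential_def)

lemma on_homogeneous_hom_differential: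
  "on_homogeneous (\<Gamma> M A) (\<Gamma> M E) (D d \<Phi>) = D d \<Phi>"
  by (simp add: hom_differential_def on_homogeneous_idem)

text \<open>Each of the three summands raises the degree by one. The sign in the last one depends on
  \<open>X\<close> only through its degree, so it is constant under sums and multiples within one
  component.\<close>

lemma hom_differential_bilin:
  assumes \<Phi>: "bilin d \<Phi>"
  shows "bilin (d + 1) (D d \<Phi>)"
proof (rule graded_bilinearI, goal_cases)
  case (1 k l X s)
  have "QE (\<Phi> X s) \<in> \<Gamma> M E (k + l + (d + 1))"
    using QE_mem[OF graded_bilinear_mem[OF \<Phi> 1]] by (simp add: ac_simps)
  moreover have "\<Phi> (QA X) s \<in> \<Gamma> M E (k + l + (d + 1))"
    using graded_bilinear_mem[OF \<Phi> QA_mem[OF 1(1)] 1(2)] by (simp add: ac_simps)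
  moreover have "\<Phi> X (QE s) \<in> \<Gamma> M E (k + l + (d + 1))"
    using graded_bilinear_mem[OF \<Phi> 1(1) QE_mem[OF 1(2)]] by (simp add: ac_simps)
  ultimately show ?case
    unfolding hom_differential_apply[OF \<Phi> 1]
    by (intro subspace_diff subspace_scale subspace_E)
next
  case (2 k l X Y s)
  show ?case
    using graded_bilinear_add_left[OF \<Phi> 2(3)] 2(1,2) QA_mem[OF 2(1)] QA_mem[OF 2(2)]
      QE_add[OF graded_bilinear_mem[OF \<Phi> 2(1,3)] graded_bilinear_mem[OF \<Phi> 2(2,3)]]
      graded_bilinear_add_left[OF \<Phi> QE_mem[OF 2(3)] 2(1,2)] QA_add[OF 2(1,2)]
    by (simp add: hom_differential_apply[OF \<Phi> subspace_add[OF subspace_A 2(1,2)] 2(3)]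
        hom_differential_apply[OF \<Phi> 2(1,3)] hom_differential_apply[OF \<Phi> 2(2,3)] scaleR_add_right)
next
  case (3 k l X s t)
  show ?case
    using graded_bilinear_add_right[OF \<Phi> 3] QE_add[OF 3(2,3)]
      QE_add[OF graded_bilinear_mem[OF \<Phi> 3(1,2)] graded_bilinear_mem[OF \<Phi> 3(1,3)]]
      graded_bilinear_add_right[OF \<Phi> QA_mem[OF 3(1)] 3(2,3)]
      graded_bilinear_add_right[OF \<Phi> 3(1) QE_mem[OF 3(2)] QE_mem[OF 3(3)]]
    by (simp add: hom_differential_apply[OF \<Phi> 3(1) subspace_add[OF subspace_E 3(2,3)]]
        hom_differential_apply[OF \<Phi> 3(1,2)] hom_differential_apply[OF \<Phi> 3(1,3)] scaleR_add_right)
next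
  case (4 k l X s c)
  show ?case
    using graded_bilinear_scaleR_left[OF \<Phi> 4(2,1)] QA_scaleR[OF 4(1)]
      QE_scaleR[OF graded_bilinear_mem[OF \<Phi> 4]]
      graded_bilinear_scaleR_left[OF \<Phi> 4(2) QA_mem[OF 4(1)]]
      graded_bilinear_scaleR_left[OF \<Phi> QE_mem[OF 4(2)] 4(1)]
    by (simp add: hom_differential_apply[OF \<Phi> subspace_scale[OF subspace_A 4(1)] 4(2)]
        hom_differential_apply[OF \<Phi> 4] scaleR_diff_right mult.commute)
next
  case (5 k l X s c)
  show ?case
    using graded_bilinear_scaleR_right[OF \<Phi> 5] QE_scaleR[OF 5(2)]
      QE_scaleR[OF graded_bilinear_mem[OF \<Phi> 5]]
      graded_bilinear_scaleR_right[OF \<Phi> QA_mem[OF 5(1)] 5(2)]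
      graded_bilinear_scaleR_right[OF \<Phi> 5(1) QE_mem[OF 5(2)]]
    by (simp add: hom_differential_apply[OF \<Phi> 5(1) subspace_scale[OF subspace_E 5(2)]]
        hom_differential_apply[OF \<Phi> 5] scaleR_diff_right mult.commute)
qed

lemma on_homogeneous_bilin:
  assumes "bilin d \<Phi>"
  shows "bilin d (on_homogeneous (\<Gamma> M A) (\<Gamma> M E) \<Phi>)"
proof (rule graded_bilinearI, goal_cases)
  case (1 k l X s)
  then show ?case
    by (simp add: on_homogeneous_apply graded_bilinear_mem[OF assms])
next
  case (2 k l X Y s)
  with subspace_add[OF subspace_A 2(1,2)] show ?case
    by (simp add: on_homogeneous_apply graded_bilinear_add_left[OF assms])
next
  case (3 k l X s t)
  with subspace_add[OF subspace_E 3(2,3)] show ?case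
    by (simp add: on_homogeneous_apply graded_bilinear_add_right[OF assms])
next
  case (4 k l X s c)
  with subspace_scale[OF subspace_A 4(1), of c] show ?case
    by (simp add: on_homogeneous_apply graded_bilinear_scaleR_left[OF assms])
next
  case (5 k l X s c)
  with subspace_scale[OF subspace_E 5(2), of c] show ?case
    by (simp add: on_homogeneous_apply graded_bilinear_scaleR_right[OF assms])
qed

text \<open>Expanding twice gives nine terms. Three contain a square of \<open>QE\<close> or
  \<open>QA\<close> and vanish; the six mixed ones cancel in pairs. Stating this for real bilinear
  maps allows \<open>nabla\<close> itself to be inserted for \<Phi>.\<close>

lemma hom_differential_squared:
  assumes \<Phi>: "bilin d \<Phi>"
  shows "D (d + 1) (D d \<Phi>) = (\<lambda>X s. 0)"
proof (rule on_homogeneous_eqI[OF on_homogeneous_hom_differential on_homogeneous_zero])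
  fix k l X s
  assume X: "X \<in> \<Gamma> M A k" and s: "s \<in> \<Gamma> M E l"
  note QX = QA_mem[OF X] and Qs = QE_mem[OF s]
  note a = QE_mem[OF graded_bilinear_mem[OF \<Phi> X s]]
    and b = graded_bilinear_mem[OF \<Phi> QX s] and c = graded_bilinear_mem[OF \<Phi> X Qs]
  let ?n = "k + l + d + 1"
  \<comment> \<open>\<open>QE\<close> is known to be additive only within a single degree, so all
    three summands of \<open>D d \<Phi> X s\<close> are first placed in the component
    \<open>?n\<close>.\<close>
  have b': "\<Phi> (QA X) s \<in> \<Gamma> M E ?n" and c': "\<Phi> X (QE s) \<in> \<Gamma> M E ?n"
    using b c by (simp_all add: ac_simps)
  note bs = subspace_scale[OF subspace_E b'] and cs = subspace_scale[OF subspace_E c']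
  have "QE (D d \<Phi> X s) =
      - (koszul d *\<^sub>R QE (\<Phi> (QA X) s)) - koszul (d + k) *\<^sub>R QE (\<Phi> X (QE s))"
    using QE_diff[OF subspace_diff[OF subspace_E a bs] cs] QE_diff[OF a bs]
      QE_scaleR[OF b'] QE_scaleR[OF c'] QE_QE[OF graded_bilinear_mem[OF \<Phi> X s]]
    by (simp add: hom_differential_apply[OF \<Phi> X s])
  moreover have "D d \<Phi> (QA X) s =
      QE (\<Phi> (QA X) s) - koszul (d + (k + 1)) *\<^sub>R \<Phi> (QA X) (QE s)"
    using hom_differential_apply[OF \<Phi> QX s] QA_QA[OF X] bilin_zero(1)[OF \<Phi> s] by simp
  moreover have "D d \<Phi> X (QE s) = QE (\<Phi> X (QE s)) - koszul d *\<^sub>R \<Phi> (QA X) (QE s)"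
    using hom_differential_apply[OF \<Phi> X Qs] QE_QE[OF s] bilin_zero(2)[OF \<Phi> X] by simp
  \<comment> \<open>All signs are products of \<open>koszul d\<close>, \<open>koszul k\<close> and
    constants; replacing these two by 1 or -1 leaves linear identities.\<close>
  ultimately show "D (d + 1) (D d \<Phi>) X s = 0"
    using koszul_cases[of d] koszul_cases[of k]
    by (auto simp: hom_differential_apply[OF hom_differential_bilin[OF \<Phi>] X s] koszul_add)
qed

text \<open>Additivity of \<open>D\<close> in the form needed later: it subtracts primitives of
  coboundaries and compares the Atiyah maps of two connections.\<close>

lemma hom_differential_diff:
  assumes \<Phi>: "bilin d \<Phi>" and \<Psi>: "bilin d \<Psi>"
  shows "D d (\<lambda>X s. \<Phi> X s - \<Psi> X s) = (\<lambda>X s. D d \<Phi> X s - D d \<Psi> X s)"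
proof (rule on_homogeneous_eqI[OF on_homogeneous_hom_differential])
  show "on_homogeneous (\<Gamma> M A) (\<Gamma> M E) (\<lambda>X s. D d \<Phi> X s - D d \<Psi> X s) =
      (\<lambda>X s. D d \<Phi> X s - D d \<Psi> X s)"
    by (simp add: on_homogeneous_diff on_homogeneous_hom_differential)
  fix k l X s
  assume X: "X \<in> \<Gamma> M A k" and s: "s \<in> \<Gamma> M E l"
  have "bilin d (\<lambda>X s. \<Phi> X s - \<Psi> X s)"
    using graded_space_E \<Phi> \<Psi> by (rule graded_bilinear_diff)
  from hom_differential_apply[OF this X s]
  show "D d (\<lambda>X s. \<Phi> X s - \<Psi> X s) X s = D d \<Phi> X s - D d \<Psi> X s"
    using QE_diff[OF graded_bilinear_mem[OF \<Phi> X s] graded_bilinear_mem[OF \<Psi> X s]]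
    by (simp add: hom_differential_apply[OF \<Phi> X s] hom_differential_apply[OF \<Psi> X s] algebra_simps)
qed

text \<open>\<open>D\<close> evaluates its argument only at homogeneous elements, since
  \<open>QA\<close> and \<open>QE\<close> preserve homogeneity. Hence a map may be normalised into
  \<open>hom_sections\<close> without changing its differential.\<close>

lemma hom_differential_on_homogeneous:
  assumes \<Phi>: "bilin d \<Phi>"
  shows "D d (on_homogeneous (\<Gamma> M A) (\<Gamma> M E) \<Phi>) = D d \<Phi>"
proof (rule on_homogeneous_eqI[OF on_homogeneous_hom_differential on_homogeneous_hom_differential])
  fix k l X s
  assume X: "X \<in> \<Gamma> M A k" and s: "s \<in> \<Gamma> M E l"
  then show "D d (on_homogeneous (\<Gamma> M A) (\<Gamma> M E) \<Phi>) X s = D d \<Phi> X s"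
    by (simp add: hom_differential_apply[OF \<Phi> X s]
        hom_differential_apply[OF on_homogeneous_bilin[OF \<Phi>] X s]
        on_homogeneous_sections[OF X s] on_homogeneous_sections[OF X QE_mem[OF s]]
        on_homogeneous_sections[OF QA_mem[OF X] s])
qed

section \<open>Maps that are bilinear over functions\<close>

lemma bundle_map_bilin: "bundle_map M A E d \<Phi> \<Longrightarrow> bilin d \<Phi>"
  by (simp add: bundle_map_def)

lemma bundle_mapI:
  assumes "bilin d \<Phi>"
    and "\<And>k l j f X s. f \<in> Cinf M k \<Longrightarrow> X \<in> \<Gamma> M A l \<Longrightarrow> s \<in> \<Gamma> M E j \<Longrightarrow>
      \<Phi> (smult M A f X) s = koszul (d * k) *\<^sub>R smult M E f (\<Phi> X s)"
    and "\<And>k l j f X s. f \<in> Cinf M k \<Longrightarrow> X \<in> \<Gamma> M A l \<Longrightarrow> s \<in> \<Gamma> M E j \<Longrightarrow>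
      \<Phi> (smult M A f X) s = koszul (k * l) *\<^sub>R \<Phi> X (smult M E f s)"
  shows "bundle_map M A E d \<Phi>"
  using assms unfolding bundle_map_def by blast

lemma smult_A_mem: "f \<in> Cinf M k \<Longrightarrow> X \<in> \<Gamma> M A l \<Longrightarrow> smult M A f X \<in> \<Gamma> M A (k + l)"
  and smult_E_mem: "f \<in> Cinf M k \<Longrightarrow> s \<in> \<Gamma> M E l \<Longrightarrow> smult M E f s \<in> \<Gamma> M E (k + l)"
  using graded_bilinear_mem[OF smult_A, of f k X l] graded_bilinear_mem[OF smult_E, of f k s l]
  by simp_all

lemma smult_E_diff:
  "f \<in> Cinf M k \<Longrightarrow> s \<in> \<Gamma> M E l \<Longrightarrow> t \<in> \<Gamma> M E l \<Longrightarrow>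
    smult M E f (s - t) = smult M E f s - smult M E f t"
  using graded_linear_diff[OF graded_space_E graded_bilinear_right[OF smult_E]] by blast

lemmas smult_E_scaleR = graded_bilinear_scaleR_right[OF smult_E]

lemma bundle_map_diff:
  assumes \<Phi>: "bundle_map M A E d \<Phi>" and \<Psi>: "bundle_map M A E d \<Psi>"
  shows "bundle_map M A E d (\<lambda>X s. \<Phi> X s - \<Psi> X s)"
proof (rule bundle_mapI)
  note \<Phi>' = bundle_map_bilin[OF \<Phi>] and \<Psi>' = bundle_map_bilin[OF \<Psi>]
  show "bilin d (\<lambda>X s. \<Phi> X s - \<Psi> X s)"
    using graded_space_E \<Phi>' \<Psi>' by (rule graded_bilinear_diff)
  fix k l j f X s
  assume f: "f \<in> Cinf M k" and X: "X \<in> \<Gamma> M A l" and s: "s \<in> \<Gamma> M E j"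
  have "\<Theta> (smult M A f X) s = koszul (d * k) *\<^sub>R smult M E f (\<Theta> X s)"
    "\<Theta> (smult M A f X) s = koszul (k * l) *\<^sub>R \<Theta> X (smult M E f s)"
    if "bundle_map M A E d \<Theta>" for \<Theta>
    using that f X s unfolding bundle_map_def by blast+
  note linear = this[OF \<Phi>] this[OF \<Psi>]
  show "\<Phi> (smult M A f X) s - \<Psi> (smult M A f X) s =
      koszul (d * k) *\<^sub>R smult M E f (\<Phi> X s - \<Psi> X s)"
    using linear(1,3)
      smult_E_diff[OF f graded_bilinear_mem[OF \<Phi>' X s] graded_bilinear_mem[OF \<Psi>' X s]]
    by (simp add: scaleR_diff_right)
  show "\<Phi> (smult M A f X) s - \<Psi> (smult M A f X) s =
      koszul (k * l) *\<^sub>R (\<Phi> X (smult M E f s) - \<Psi> X (smult M E f s))"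
    using linear(2,4) by (simp add: scaleR_diff_right)
qed

lemma bundle_map_on_homogeneous:
  assumes \<Phi>: "bundle_map M A E d \<Phi>"
  shows "bundle_map M A E d (on_homogeneous (\<Gamma> M A) (\<Gamma> M E) \<Phi>)"
proof (rule bundle_mapI)
  show "bilin d (on_homogeneous (\<Gamma> M A) (\<Gamma> M E) \<Phi>)"
    using \<Phi> by (intro on_homogeneous_bilin bundle_map_bilin)
  fix k l j f X s
  assume f: "f \<in> Cinf M k" and X: "X \<in> \<Gamma> M A l" and s: "s \<in> \<Gamma> M E j"
  note fX = smult_A_mem[OF f X] and fs = smult_E_mem[OF f s]
  have "\<Phi> (smult M A f X) s = koszul (d * k) *\<^sub>R smult M E f (\<Phi> X s)"
    "\<Phi> (smult M A f X) s = koszul (k * l) *\<^sub>R \<Phi> X (smult M E f s)"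
    using \<Phi> f X s unfolding bundle_map_def by blast+
  then show "on_homogeneous (\<Gamma> M A) (\<Gamma> M E) \<Phi> (smult M A f X) s =
      koszul (d * k) *\<^sub>R smult M E f (on_homogeneous (\<Gamma> M A) (\<Gamma> M E) \<Phi> X s)"
    and "on_homogeneous (\<Gamma> M A) (\<Gamma> M E) \<Phi> (smult M A f X) s =
      koszul (k * l) *\<^sub>R on_homogeneous (\<Gamma> M A) (\<Gamma> M E) \<Phi> X (smult M E f s)"
    by (simp_all only: on_homogeneous_sections[OF X s]
        on_homogeneous_sections[OF fX s] on_homogeneous_sections[OF X fs])
qed

section \<open>The cohomology relation on cocycles\<close>

lemma hom_sections_bilin: "\<Phi> \<in> hom_sections M A E d \<Longrightarrow> bilin d \<Phi>"
  by (simp add: hom_sections_def bundle_map_bilin)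

lemma hom_sections_diff:
  "\<Phi> \<in> hom_sections M A E d \<Longrightarrow> \<Psi> \<in> hom_sections M A E d \<Longrightarrow>
    (\<lambda>X s. \<Phi> X s - \<Psi> X s) \<in> hom_sections M A E d"
  by (simp add: hom_sections_def bundle_map_diff on_homogeneous_diff)

text \<open>The difference of the two primitives is a primitive of \<Phi> - \<Phi>'. Together with
  reflexivity, this single rule yields both symmetry and transitivity.\<close>

lemma cohomologous_symtrans:
  assumes "(\<Phi>, \<Theta>) \<in> cohomologous M A QA E QE d" "(\<Phi>', \<Theta>) \<in> cohomologous M A QA E QE d"
  shows "(\<Phi>, \<Phi>') \<in> cohomologous M A QA E QE d"
proof -
  obtain \<Psi> \<Psi>' where \<Psi>: "\<Psi> \<in> hom_sections M A E (d - 1)" "\<Psi>' \<in> hom_sections M A E (d - 1)"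
    and eq: "(\<lambda>X s. \<Phi> X s - \<Theta> X s) = D (d - 1) \<Psi>" "(\<lambda>X s. \<Phi>' X s - \<Theta> X s) = D (d - 1) \<Psi>'"
    using assms unfolding cohomologous_def by blast
  have "(\<lambda>X s. \<Phi> X s - \<Phi>' X s) = (\<lambda>X s. D (d - 1) \<Psi> X s - D (d - 1) \<Psi>' X s)"
    by (simp flip: eq)
  also have "\<dots> = D (d - 1) (\<lambda>X s. \<Psi> X s - \<Psi>' X s)"
    using \<Psi> by (simp add: hom_differential_diff hom_sections_bilin)
  finally show ?thesis
    using assms hom_sections_diff[OF \<Psi>] unfolding cohomologous_def by blast
qed

text \<open>Supplies the primitive that witnesses reflexivity of
  \<open>cohomologous\<close>.\<close>

lemma zero_hom_section: "(\<lambda>X s. 0) \<in> hom_sections M A E d"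
proof -
  have "bundle_map M A E d (\<lambda>X s. 0)"
  proof (rule bundle_mapI)
    show "bilin d (\<lambda>X s. 0)"
      by (rule graded_bilinearI) (simp_all add: subspace_0[OF subspace_E])
    show "0 = koszul (d * k) *\<^sub>R smult M E f 0" if "f \<in> Cinf M k" for k f
      using graded_linear_zero[OF graded_space_E graded_bilinear_right[OF smult_E that]] by simp
  qed simp
  then show ?thesis
    by (simp add: hom_sections_def on_homogeneous_zero)
qed

lemma equiv_cohomologous: "equiv (cocycles M A QA E QE d) (cohomologous M A QA E QE d)"
proof -
  \<comment> \<open>Additivity applied to the difference 0 - 0.\<close>
  have "D (d - 1) (\<lambda>X s. 0) = (\<lambda>X s. 0)"
    using hom_differential_diff[OF hom_sections_bilin hom_sections_bilin,
        OF zero_hom_section zero_hom_section] by simp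
  then have refl: "(\<Phi>, \<Phi>) \<in> cohomologous M A QA E QE d" if "\<Phi> \<in> cocycles M A QA E QE d" for \<Phi>
    using that by (auto simp: cohomologous_def intro!: bexI[OF _ zero_hom_section])
  have sym: "(\<Theta>, \<Phi>) \<in> cohomologous M A QA E QE d" if "(\<Phi>, \<Theta>) \<in> cohomologous M A QA E QE d" for \<Phi> \<Theta>
  \<comment> \<open>Both \<Theta> and \<Phi> are cohomologous to \<Theta>, the former by
    reflexivity.\<close>
  proof (rule cohomologous_symtrans[OF _ that])
    show "(\<Theta>, \<Theta>) \<in> cohomologous M A QA E QE d"
      using that by (intro refl) (simp add: cohomologous_def)
  qed
  show ?thesis
  proof (rule equivI)
    show "cohomologous M A QA E QE d \<subseteq> cocycles M A QA E QE d \<times> cocycles M A QA E QE d"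
      by (auto simp: cohomologous_def)
    show "refl_on (cocycles M A QA E QE d) (cohomologous M A QA E QE d)"
      using refl by (rule refl_onI)
    show "sym (cohomologous M A QA E QE d)"
      using sym by (rule symI)
    show "trans (cohomologous M A QA E QE d)"
      by (rule transI) (rule cohomologous_symtrans[OF _ sym])
  qed
qed

end

section \<open>Connections and the Atiyah cocycle\<close>

locale atiyah_setting = dg_vector_bundles M Q A QA E QE
  for M :: "('p, 'i::linorder, 'f::real_vector) graded_mfd"
    and Q :: "'f \<Rightarrow> 'f"
    and A :: "('p, 'f, 'a::real_vector) module_sheaf"
    and QA :: "'a \<Rightarrow> 'a"
    and E :: "('p, 'f, 'e::real_vector) module_sheaf"
    and QE :: "'e \<Rightarrow> 'e" +
  fixes br :: "'a \<Rightarrow> 'a \<Rightarrow> 'a"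
    and \<rho> :: "'a \<Rightarrow> 'f \<Rightarrow> 'f"
  assumes dg_M: "dg_manifold M Q"
    and algebroid: "dg_lie_algebroid M Q A QA br \<rho>"
begin

lemma Q_mem: "f \<in> Cinf M k \<Longrightarrow> Q f \<in> Cinf M (k + 1)"
  using dg_M graded_linear_mem unfolding dg_manifold_def vector_field_def by blast

lemma anchor_mem: "X \<in> \<Gamma> M A k \<Longrightarrow> f \<in> Cinf M l \<Longrightarrow> \<rho> X f \<in> Cinf M (k + l)"
  using algebroid graded_bilinear_mem[of "\<Gamma> M A" "Cinf M" "Cinf M" 0 \<rho> X k f l]
  unfolding dg_lie_algebroid_def graded_lie_algebroid_def by simp

text \<open>The compatibility of the anchor with the homological vector fields, with the commutator
  expanded. It removes the anchor terms that contain second derivatives of \<open>f\<close> when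
  \<open>f\<close> multiplies \<open>s\<close>.\<close>

lemma anchor_QA:
  assumes "X \<in> \<Gamma> M A k" "f \<in> Cinf M l"
  shows "\<rho> (QA X) f = Q (\<rho> X f) - koszul k *\<^sub>R \<rho> X (Q f)"
proof -
  have "\<rho> (QA X) f = commutator 1 Q k (\<rho> X) f"
    using algebroid assms unfolding dg_lie_algebroid_def by blast
  then show ?thesis
    by (simp add: commutator_def)
qed

lemma smult_E_diff_left:
  assumes "f \<in> Cinf M k" "g \<in> Cinf M k" "s \<in> \<Gamma> M E l"
  shows "smult M E (f - c *\<^sub>R g) s = smult M E f s - c *\<^sub>R smult M E g s"
proof -
  have sheaf: "sheaf_of_graded_algebras (topo (base M)) (funs M)"
    using dg_M by (simp add: dg_manifold_def graded_manifold_def)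
  note algebras = sheaf[unfolded sheaf_of_graded_algebras_def, THEN conjunct2, THEN conjunct1]
  have C: "graded_space (Cinf M)"
    using algebras[THEN spec, THEN mp, OF openin_topspace]
    unfolding graded_commutative_algebra_def by (rule conjunct1)
  note linear = graded_bilinear_left[OF smult_E assms(3)]
  show ?thesis
    using graded_linear_diff[OF C linear assms(1) subspace_scale[OF graded_spaceD[OF C] assms(2)]]
      graded_linear_scaleR[OF linear assms(2)] by simp
qed

context
  fixes nabla :: "'a \<Rightarrow> 'e \<Rightarrow> 'e"
  assumes connection: "lie_connection M A \<rho> E nabla"
begin

lemma connection_bilin: "bilin 0 nabla"
  using connection by (simp add: lie_connection_def)

lemma connection_smult_left:
  "f \<in> Cinf M k \<Longrightarrow> X \<in> \<Gamma> M A l \<Longrightarrow> s \<in> \<Gamma> M E j \<Longrightarrow>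
    nabla (smult M A f X) s = smult M E f (nabla X s)"
  using connection unfolding lie_connection_def by blast

lemma connection_Leibniz:
  "f \<in> Cinf M k \<Longrightarrow> X \<in> \<Gamma> M A l \<Longrightarrow> s \<in> \<Gamma> M E j \<Longrightarrow>
    nabla X (smult M E f s) =
      smult M E (\<rho> X f) s + koszul (l * k) *\<^sub>R smult M E f (nabla X s)"
  using connection unfolding lie_connection_def by blast

text \<open>Linearity in \<open>X\<close> holds because \<open>QE\<close> and \<open>QA\<close>
  produce the same term \<open>(Q f) nabla X s\<close>, once with each sign. For \<open>f s\<close>,
  the two terms with \<open>Q f\<close> acting on \<open>nabla X s\<close> cancel, as do the two
  with \<open>\<rho> X f\<close> acting on \<open>QE s\<close>; the remaining anchor terms cancel by
  \<open>anchor_QA\<close>.\<close>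

lemma bundle_map_atiyah: "bundle_map M A E 1 (D 0 nabla)"
proof (rule bundle_mapI)
  show "bilin 1 (D 0 nabla)"
    using hom_differential_bilin[OF connection_bilin] by simp
  fix k l j f X s
  assume f: "f \<in> Cinf M k" and X: "X \<in> \<Gamma> M A l" and s: "s \<in> \<Gamma> M E j"
  note Qf = Q_mem[OF f] and QX = QA_mem[OF X] and Qs = QE_mem[OF s]
  note fX = smult_A_mem[OF f X] and fs = smult_E_mem[OF f s]
  have Xs: "nabla X s \<in> \<Gamma> M E (l + j)" and QXs: "nabla (QA X) s \<in> \<Gamma> M E (l + j + 1)"
    and XQs: "nabla X (QE s) \<in> \<Gamma> M E (l + j + 1)"
    using graded_bilinear_mem[OF connection_bilin X s] graded_bilinear_mem[OF connection_bilin QX s]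
      graded_bilinear_mem[OF connection_bilin X Qs] by (simp_all add: ac_simps)
  note QsXs = QE_mem[OF Xs] and c = subspace_scale[OF subspace_E]

  have fAt: "smult M E f (D 0 nabla X s) = smult M E f (QE (nabla X s))
      - smult M E f (nabla (QA X) s) - koszul l *\<^sub>R smult M E f (nabla X (QE s))"
    using smult_E_diff[OF f subspace_diff[OF subspace_E QsXs QXs] c[OF XQs]]
      smult_E_diff[OF f QsXs QXs] smult_E_scaleR[OF f XQs]
    by (simp add: hom_differential_apply[OF connection_bilin X s])

  have "smult M A (Q f) X \<in> \<Gamma> M A (k + l + 1)" and fQX: "smult M A f (QA X) \<in> \<Gamma> M A (k + l + 1)"
    using smult_A_mem[OF Qf X] smult_A_mem[OF f QX] by (simp_all add: ac_simps)
  then have "nabla (QA (smult M A f X)) s =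
      smult M E (Q f) (nabla X s) + koszul k *\<^sub>R smult M E f (nabla (QA X) s)"
    using graded_bilinear_add_left[OF connection_bilin s _ subspace_scale[OF subspace_A fQX]]
      graded_bilinear_scaleR_left[OF connection_bilin s fQX]
    by (simp add: QA_smult[OF f X] connection_smult_left[OF Qf X s] connection_smult_left[OF f QX s])
  then show left: "D 0 nabla (smult M A f X) s = koszul (1 * k) *\<^sub>R smult M E f (D 0 nabla X s)"
    unfolding fAt using koszul_cases[of k]
    by (auto simp: hom_differential_apply[OF connection_bilin fX s] connection_smult_left[OF f X s]
        connection_smult_left[OF f X Qs] QE_smult[OF f Xs] koszul_add)

  note rX = anchor_mem[OF X f] and rQf = anchor_mem[OF X Qf]
  have "Q (\<rho> X f) \<in> Cinf M (l + k + 1)" "\<rho> X (Q f) \<in> Cinf M (l + k + 1)"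
    using Q_mem[OF rX] rQf by (simp_all add: ac_simps)
  from smult_E_diff_left[OF this s]
  \<comment> \<open>Splits the anchor term of \<open>nabla (QA X) (f s)\<close> into the two terms
    that arise in \<open>QfXs\<close> and \<open>XQfs\<close>.\<close>
  have "smult M E (\<rho> (QA X) f) s = smult M E (Q (\<rho> X f)) s - koszul l *\<^sub>R smult M E (\<rho> X (Q f)) s"
    by (simp add: anchor_QA[OF X f])
  \<comment> \<open>\<open>QA X\<close> has degree \<open>l + 1\<close>, so its Leibniz sign has
    exponent \<open>(l + 1) * k = l * k + k\<close>.\<close>
  then have QXfs: "nabla (QA X) (smult M E f s) =
      smult M E (Q (\<rho> X f)) s - koszul l *\<^sub>R smult M E (\<rho> X (Q f)) s
      + koszul (l * k + k) *\<^sub>R smult M E f (nabla (QA X) s)"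
    by (simp add: connection_Leibniz[OF f QX s] algebra_simps)
  have "smult M E (\<rho> X f) s \<in> \<Gamma> M E (k + (l + j))"
    using smult_E_mem[OF rX s] by (simp add: ac_simps)
  note QE_add[OF this c[OF smult_E_mem[OF f Xs]]] QE_scaleR[OF smult_E_mem[OF f Xs]]
  then have QfXs: "QE (nabla X (smult M E f s)) =
      smult M E (Q (\<rho> X f)) s + koszul (l + k) *\<^sub>R smult M E (\<rho> X f) (QE s)
      + koszul (l * k) *\<^sub>R (smult M E (Q f) (nabla X s) + koszul k *\<^sub>R smult M E f (QE (nabla X s)))"
    by (simp add: connection_Leibniz[OF f X s] QE_smult[OF rX s] QE_smult[OF f Xs])
  have Qfs: "smult M E (Q f) s \<in> \<Gamma> M E (k + j + 1)" and fQs: "smult M E f (QE s) \<in> \<Gamma> M E (k + j + 1)"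
    using smult_E_mem[OF Qf s] smult_E_mem[OF f Qs] by (simp_all add: ac_simps)
  have XQfs: "nabla X (QE (smult M E f s)) =
      smult M E (\<rho> X (Q f)) s + koszul (l * (k + 1)) *\<^sub>R smult M E (Q f) (nabla X s)
      + koszul k *\<^sub>R (smult M E (\<rho> X f) (QE s) + koszul (l * k) *\<^sub>R smult M E f (nabla X (QE s)))"
    using graded_bilinear_add_right[OF connection_bilin X Qfs subspace_scale[OF subspace_E fQs]]
      graded_bilinear_scaleR_right[OF connection_bilin X fQs]
    by (simp add: QE_smult[OF f s] connection_Leibniz[OF Qf X s] connection_Leibniz[OF f X Qs])
  \<comment> \<open>The sign is that of moving \<open>f\<close> past \<open>X\<close> and past an
    operator of degree 1. After expansion, the signs of \<open>k\<close>, \<open>l\<close> and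
    \<open>k * l\<close> may be treated as independent.\<close>
  have "D 0 nabla X (smult M E f s) = koszul (k * l + k) *\<^sub>R smult M E f (D 0 nabla X s)"
    unfolding fAt hom_differential_apply[OF connection_bilin X fs] QXfs QfXs XQfs
    using koszul_cases[of k] koszul_cases[of l] koszul_cases[of "k * l"]
    by (auto simp: koszul_add distrib_left mult.commute[of l k])
  \<comment> \<open>\<open>bundle_map\<close> relates \<open>f X\<close> to \<open>f s\<close>
    directly; the square of \<open>koszul (k * l)\<close> being 1, this follows by comparing both
    with \<open>f\<close> applied to the value.\<close>
  then show "D 0 nabla (smult M A f X) s = koszul (k * l) *\<^sub>R D 0 nabla X (smult M E f s)"
    unfolding left using koszul_cases[of "k * l"] by (auto simp: koszul_add)
qed

lemma atiyah_hom_section: "D 0 nabla \<in> hom_sections M A E 1"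
  by (simp add: hom_sections_def bundle_map_atiyah on_homogeneous_hom_differential)

text \<open>This is the vanishing square of \<open>D\<close> applied to the connection.\<close>

lemma atiyah_cocycle: "D 0 nabla \<in> cocycles M A QA E QE 1"
  using hom_differential_squared[OF connection_bilin]
  by (simp add: cocycles_def atiyah_hom_section)

end

text \<open>Both Leibniz rules contain the same anchor term \<open>\<rho> X f\<close> acting on
  \<open>s\<close>, which drops out of the difference.\<close>

lemma connection_diff:
  assumes "lie_connection M A \<rho> E nabla" "lie_connection M A \<rho> E nabla'"
  shows "bundle_map M A E 0 (\<lambda>X s. nabla X s - nabla' X s)"
proof (rule bundle_mapI)
  note bilin = assms[THEN connection_bilin]
  show "bilin 0 (\<lambda>X s. nabla X s - nabla' X s)"
    using graded_space_E bilin by (rule graded_bilinear_diff)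
  fix k l j f X s
  assume f: "f \<in> Cinf M k" and X: "X \<in> \<Gamma> M A l" and s: "s \<in> \<Gamma> M E j"
  show left: "nabla (smult M A f X) s - nabla' (smult M A f X) s =
      koszul (0 * k) *\<^sub>R smult M E f (nabla X s - nabla' X s)"
    using smult_E_diff[OF f bilin[THEN graded_bilinear_mem, OF X s]]
    by (simp add: assms[THEN connection_smult_left, OF f X s])
  have "nabla X (smult M E f s) - nabla' X (smult M E f s) =
      koszul (k * l) *\<^sub>R smult M E f (nabla X s - nabla' X s)"
    using smult_E_diff[OF f bilin[THEN graded_bilinear_mem, OF X s]]
    by (simp add: assms[THEN connection_Leibniz, OF f X s] scaleR_diff_right mult.commute)
  then show "nabla (smult M A f X) s - nabla' (smult M A f X) s =
      koszul (k * l) *\<^sub>R (nabla X (smult M E f s) - nabla' X (smult M E f s))"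
    unfolding left using koszul_cases[of "k * l"] by auto
qed

text \<open>The primitive is the difference of the connections. It is normalised first, since two
  connections may differ arbitrarily at inhomogeneous arguments.\<close>

lemma atiyah_cohomologous:
  assumes "lie_connection M A \<rho> E nabla" "lie_connection M A \<rho> E nabla'"
  shows "(D 0 nabla, D 0 nabla') \<in> cohomologous M A QA E QE 1"
proof -
  let ?\<Psi> = "\<lambda>X s. nabla X s - nabla' X s"
  note \<Psi> = connection_diff[OF assms]
  have "on_homogeneous (\<Gamma> M A) (\<Gamma> M E) ?\<Psi> \<in> hom_sections M A E 0"
    by (simp add: hom_sections_def bundle_map_on_homogeneous[OF \<Psi>] on_homogeneous_idem)
  moreover have "D 0 (on_homogeneous (\<Gamma> M A) (\<Gamma> M E) ?\<Psi>) = (\<lambda>X s. D 0 nabla X s - D 0 nabla' X s)"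
    by (simp only: hom_differential_on_homogeneous[OF bundle_map_bilin[OF \<Psi>]]
        hom_differential_diff[OF assms[THEN connection_bilin]])
  ultimately show ?thesis
    using assms[THEN atiyah_cocycle] by (auto simp: cohomologous_def intro!: bexI)
qed

end

theorem proposition2p1:
  fixes M :: "('p, 'i::linorder, 'f::real_vector) graded_mfd"
    and Q :: "'f \<Rightarrow> 'f"
    and E :: "('p, 'f, 'e::real_vector) module_sheaf"
    and QE :: "'e \<Rightarrow> 'e"
    and A :: "('p, 'f, 'a::real_vector) module_sheaf"
    and QA :: "'a \<Rightarrow> 'a"
    and br :: "'a \<Rightarrow> 'a \<Rightarrow> 'a"
    and \<rho> :: "'a \<Rightarrow> 'f \<Rightarrow> 'f"
    and nabla :: "'a \<Rightarrow> 'e \<Rightarrow> 'e"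
  assumes "dg_manifold M Q"
    and "dg_vector_bundle M Q E QE"
    and "dg_lie_algebroid M Q A QA br \<rho>"
    and "lie_connection M A \<rho> E nabla"
  shows "(bundle_map M A E 1 (atiyah M A QA E QE nabla) \<and>
           atiyah M A QA E QE nabla \<in> hom_sections M A E 1) \<and>
         hom_differential M A QA E QE 1 (atiyah M A QA E QE nabla) = (\<lambda>X s. 0) \<and>
         cohomology_class M A QA E QE 1 (atiyah M A QA E QE nabla)
           \<in> cohomology M A QA E QE 1 \<and>
         (\<forall>nabla'. lie_connection M A \<rho> E nabla' \<longrightarrow>
            cohomology_class M A QA E QE 1 (atiyah M A QA E QE nabla')
              = cohomology_class M A QA E QE 1 (atiyah M A QA E QE nabla))"
proof -
  have "dg_vector_bundle M Q A QA"
    using assms(3) by (simp add: dg_lie_algebroid_def)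
  then interpret atiyah_setting M Q A QA E QE br \<rho>
    using assms by unfold_locales
  note cocycle = atiyah_cocycle[OF assms(4)]
  show ?thesis
    unfolding atiyah_eq
  proof (intro conjI allI impI)
    show "hom_differential M A QA E QE 1 (hom_differential M A QA E QE 0 nabla) = (\<lambda>X s. 0)"
      using cocycle by (simp add: cocycles_def)
    show "cohomology_class M A QA E QE 1 (hom_differential M A QA E QE 0 nabla)
        \<in> cohomology M A QA E QE 1"
      unfolding cohomology_class_def cohomology_def using cocycle by (rule quotientI)
    show "cohomology_class M A QA E QE 1 (hom_differential M A QA E QE 0 nabla') =
        cohomology_class M A QA E QE 1 (hom_differential M A QA E QE 0 nabla)"
      if "lie_connection M A \<rho> E nabla'" for nabla'
      unfolding cohomology_class_def
      using equiv_cohomologous atiyah_cohomologous[OF that assms(4)] by (rule equiv_class_eq)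
  qed (use bundle_map_atiyah[OF assms(4)] atiyah_hom_section[OF assms(4)] in simp_all)
qed

end
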